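(* Let $X$ be a topological space and $x_0\in X$. If $X$ is an SLT space at $x_0$, then $\pi_1^{s}(X,x_0)=\pi_1^{sg}(X,x_0)$.
   Context: Let $I=[0,1]$; $P(X,x_0)$ denotes the set of paths $\alpha:I\to X$ with $\alpha(0)=x_0$; $\ast$ denotes concatenation and $\alpha^{-1}$ the reversed path. A path $\alpha:I\to X$ is an SLT (small loop transfer) path if for every open neighborhood $U$ of $\alpha(0)$ in $X$ there is an open neighborhood $V$ of $\alpha(1)$ in $X$ such that for every loop $\gamma$ in $V$ based at $\alpha(1)$ there is a loop $\gamma'$ in $U$ based at $\alpha(0)$ which is homotopic in $X$, relative to $\{0,1\}$, to $\alpha\ast\gamma\ast\alpha^{-1}$. The space $X$ is SLT at $x_0$ if every path in $X$ starting at $x_0$ is an SLT path. A loop $\alpha$ in $X$ based at $x$ is small if for every open neighborhood $U$ of $x$ the class $[\alpha]\in\pi_1(X,x)$ has a representative lying in $U$. $\pi_1^{s}(X,x)$ is the subgroup of $\pi_1(X,x)$ consisting of the homotopy classes of all small loops based at $x$. $\pi_1^{sg}(X,x_0)$ is the subgroup of $\pi_1(X,x_0)$ generated by the set $\{[\alpha\ast\beta\ast\alpha^{-1}] \mid [\beta]\in\pi_1^{s}(X,\alpha(1)),\ \alpha\in P(X,x_0)\}$. *)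

theory Defs
  imports "HOL-Analysis.Homotopy" "HOL-Algebra.Generated_Groups"
begin

text \<open>
  A space is a value \<open>X :: 'a topology\<close> with points \<open>topspace X\<close>; a path is a function
  \<open>p :: real \<Rightarrow> 'a\<close> with \<open>pathin X p\<close>, of which only the restriction to \<open>{0..1}\<close> matters.
  The library's \<open>joinpaths\<close>, \<open>reversepath\<close> and \<open>homotopic_paths\<close> require \<open>'a\<close> to carry a
  type-class topology, so their counterparts for an arbitrary \<open>'a topology\<close> are given here.
\<close>

definition path_concat :: "(real \<Rightarrow> 'a) \<Rightarrow> (real \<Rightarrow> 'a) \<Rightarrow> real \<Rightarrow> 'a"  (infixr \<open>\<star>\<close> 75)
  where "p \<star> q = (\<lambda>t. if t \<le> 1/2 then p (2 * t) else q (2 * t - 1))"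

definition path_reverse :: "(real \<Rightarrow> 'a) \<Rightarrow> real \<Rightarrow> 'a"
  where "path_reverse p = (\<lambda>t. p (1 - t))"

text \<open>Homotopy relative to \<open>{0, 1}\<close>; it implies that both functions are paths in \<open>X\<close>.\<close>

definition path_homotopic :: "'a topology \<Rightarrow> (real \<Rightarrow> 'a) \<Rightarrow> (real \<Rightarrow> 'a) \<Rightarrow> bool"
  where "path_homotopic X p q \<longleftrightarrow>
    homotopic_with (\<lambda>r. r 0 = p 0 \<and> r 1 = p 1) (top_of_set {0..1}) X p q"

definition loop_at :: "'a topology \<Rightarrow> 'a \<Rightarrow> (real \<Rightarrow> 'a) \<Rightarrow> bool"
  where "loop_at X x p \<longleftrightarrow> pathin X p \<and> p 0 = x \<and> p 1 = x"

definition path_class :: "'a topology \<Rightarrow> (real \<Rightarrow> 'a) \<Rightarrow> (real \<Rightarrow> 'a) set"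
  where "path_class X p = {q. path_homotopic X p q}"

text \<open>
  The product of two classes is written as a union over all representatives. Since
  concatenation respects homotopy, all members of the union are the same class.
\<close>

definition fundamental_group :: "'a topology \<Rightarrow> 'a \<Rightarrow> (real \<Rightarrow> 'a) set monoid"
  where "fundamental_group X x =
    \<lparr>carrier = {path_class X p | p. loop_at X x p},
     monoid.mult = (\<lambda>A B. \<Union>p\<in>A. \<Union>q\<in>B. path_class X (p \<star> q)),
     one = path_class X (\<lambda>_. x)\<rparr>"

definition SLT_path :: "'a topology \<Rightarrow> (real \<Rightarrow> 'a) \<Rightarrow> bool"
  where "SLT_path X \<alpha> \<longleftrightarrow> pathin X \<alpha> \<and>
    (\<forall>U. openin X U \<and> \<alpha> 0 \<in> U \<longrightarrow>
      (\<exists>V. openin X V \<and> \<alpha> 1 \<in> V \<and>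
        (\<forall>\<gamma>. loop_at (subtopology X V) (\<alpha> 1) \<gamma> \<longrightarrow>
          (\<exists>\<gamma>'. loop_at (subtopology X U) (\<alpha> 0) \<gamma>' \<and>
                 path_homotopic X \<gamma>' (\<alpha> \<star> \<gamma> \<star> path_reverse \<alpha>)))))"

definition SLT_at :: "'a topology \<Rightarrow> 'a \<Rightarrow> bool"
  where "SLT_at X x0 \<longleftrightarrow> (\<forall>\<alpha>. pathin X \<alpha> \<and> \<alpha> 0 = x0 \<longrightarrow> SLT_path X \<alpha>)"

definition small_loop :: "'a topology \<Rightarrow> 'a \<Rightarrow> (real \<Rightarrow> 'a) \<Rightarrow> bool"
  where "small_loop X x \<alpha> \<longleftrightarrow> loop_at X x \<alpha> \<and>
    (\<forall>U. openin X U \<and> x \<in> U \<longrightarrow> (\<exists>\<beta>\<in>path_class X \<alpha>. \<beta> ` {0..1} \<subseteq> U))"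

text \<open>
  The groups \<open>\<pi>\<^sub>1\<^sup>s(X, x)\<close> and \<open>\<pi>\<^sub>1\<^sup>s\<^sup>g(X, x0)\<close> are represented by their underlying sets, as is
  usual for subgroups in HOL-Algebra.
\<close>

definition pi1_small :: "'a topology \<Rightarrow> 'a \<Rightarrow> (real \<Rightarrow> 'a) set set"
  where "pi1_small X x = {path_class X \<alpha> | \<alpha>. small_loop X x \<alpha>}"

definition pi1_sg :: "'a topology \<Rightarrow> 'a \<Rightarrow> (real \<Rightarrow> 'a) set set"
  where "pi1_sg X x0 = generate (fundamental_group X x0)
    {path_class X (\<alpha> \<star> \<beta> \<star> path_reverse \<alpha>) | \<alpha> \<beta>.
      pathin X \<alpha> \<and> \<alpha> 0 = x0 \<and> loop_at X (\<alpha> 1) \<beta> \<and> path_class X \<beta> \<in> pi1_small X (\<alpha> 1)}"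

end

theory Submission
  imports Defs
begin

text \<open>
  The small-loop-transfer property says exactly that conjugating a small loop by a path starting
  at \<open>x0\<close> yields a small loop, so every generator of \<open>\<pi>\<^sub>1\<^sup>s\<^sup>g\<close> lies in the subgroup \<open>\<pi>\<^sub>1\<^sup>s\<close>.
  Conversely, a small loop is homotopic to its conjugate by the constant path.
\<close>

section \<open>Homotopy of paths in an abstract topology\<close>

text \<open>Reduces the relation to a continuous map on the unit square, the form in which
  homotopies are built below. Boundary values are asked only on \<open>{0..1}\<close>, which is
  legitimate because the endpoint condition sees a function only at 0 and 1.\<close>

lemma path_homotopic_iff:
  "path_homotopic X p q \<longleftrightarrow>
    (\<exists>h. continuous_map (prod_topology (top_of_set {0..1::real}) (top_of_set {0..1})) X h \<and>
         (\<forall>t\<in>{0..1}. h (0, t) = p t) \<and> (\<forall>t\<in>{0..1}. h (1, t) = q t) \<and>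
         (\<forall>s\<in>{0..1}. h (s, 0) = p 0 \<and> h (s, 1) = p 1))"
  unfolding path_homotopic_def by (subst homotopic_with) simp_all

lemma path_homotopicE:
  assumes "path_homotopic X p q"
  obtains h where "continuous_map (prod_topology (top_of_set {0..1::real}) (top_of_set {0..1})) X h"
    "\<forall>t\<in>{0..1}. h (0, t) = p t" "\<forall>t\<in>{0..1}. h (1, t) = q t"
    "\<forall>s\<in>{0..1}. h (s, 0) = p 0 \<and> h (s, 1) = p 1"
  using assms unfolding path_homotopic_iff by (elim exE conjE) (rule that)

lemma path_homotopic_endpoints:
  assumes "path_homotopic X p q"
  shows "q 0 = p 0" "q 1 = p 1"
  using homotopic_with_imp_property[OF assms[unfolded path_homotopic_def]] by auto

lemma path_homotopic_pathin:
  assumes "path_homotopic X p q"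
  shows "pathin X p" "pathin X q"
  using homotopic_with_imp_continuous_maps[OF assms[unfolded path_homotopic_def]]
  by (auto simp: pathin_def)

lemma path_homotopic_refl: "path_homotopic X p p \<longleftrightarrow> pathin X p"
  by (simp add: path_homotopic_def pathin_def)

lemma path_homotopic_sym:
  assumes "path_homotopic X p q"
  shows "path_homotopic X q p"
  using assms path_homotopic_endpoints[OF assms]
  unfolding path_homotopic_def by (simp add: homotopic_with_sym)

lemma path_homotopic_trans [trans]:
  assumes "path_homotopic X p q" "path_homotopic X q r"
  shows "path_homotopic X p r"
  using assms path_homotopic_endpoints[OF assms(1)]
  unfolding path_homotopic_def by (auto intro: homotopic_with_trans)

text \<open>
  The group laws all arise from this lemma: both sides of each law are reparametrisations of a
  single path, so the straight-line homotopy between the parameter functions suffices.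
\<close>

lemma path_homotopic_reparam:
  assumes p: "pathin X p"
    and f: "continuous_on {0..1} f" "f ` {0..1} \<subseteq> {0..1}"
    and g: "continuous_on {0..1} g" "g ` {0..1} \<subseteq> {0..1}"
    and eq: "f 0 = g 0" "f 1 = g 1"
    and a: "\<And>t. t \<in> {0..1} \<Longrightarrow> a t = p (f t)"
    and b: "\<And>t. t \<in> {0..1} \<Longrightarrow> b t = p (g t)"
  shows "path_homotopic X a b"
proof -
  define k where "k = (\<lambda>(s, t). (1 - s) * f t + s * g t)"
  \<comment> \<open>Convexity of the interval keeps the straight-line homotopy inside the domain
    where \<open>p\<close> is continuous.\<close>
  have "k (s, t) \<in> {0..1}" if "s \<in> {0..1}" "t \<in> {0..1}" for s t
  proof -
    have "f t \<in> {0..1}" "g t \<in> {0..1}"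
      using f(2) g(2) that by blast+
    then show ?thesis
      using that convexD_alt[OF convex_real_interval(5), of "f t" 0 1 "g t" s] by (simp add: k_def)
  qed
  then have "k ` ({0..1} \<times> {0..1}) \<subseteq> {0..1}"
    by auto
  moreover have "continuous_on ({0..1} \<times> {0..1}) k"
    unfolding k_def case_prod_unfold
    by (intro continuous_intros continuous_on_compose2[OF f(1)] continuous_on_compose2[OF g(1)]) auto
  ultimately have "continuous_map (prod_topology (top_of_set {0..1}) (top_of_set {0..1})) (top_of_set {0..1}) k"
    by (auto simp: prod_topology_subtopology_eu continuous_map_in_subtopology)
  then have "continuous_map (prod_topology (top_of_set {0..1}) (top_of_set {0..1})) X (p \<circ> k)"
    using p unfolding pathin_def by (rule continuous_map_compose)
  \<comment> \<open>Since \<open>f\<close> and \<open>g\<close> agree at 0 and 1, the segment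
    between them is a single point there, so the homotopy fixes endpoints.\<close>
  moreover have "(1 - s) * f 0 + s * g 0 = f 0" "(1 - s) * f 1 + s * g 1 = f 1" for s
    using eq by (auto simp: algebra_simps)
  ultimately show ?thesis
    unfolding path_homotopic_iff
    by (intro exI[of _ "p \<circ> k"]) (simp add: k_def a b)
qed

section \<open>Compatibility of concatenation and reversal with homotopy\<close>

lemma path_homotopic_concat:
  assumes "path_homotopic X p p'" "path_homotopic X q q'" and pq: "p 1 = q 0"
  shows "path_homotopic X (p \<star> q) (p' \<star> q')"
proof -
  let ?I = "top_of_set {0..1::real}"
  let ?Q = "prod_topology ?I ?I"
  obtain h where h: "continuous_map ?Q X h"
    "\<forall>t\<in>{0..1}. h (0, t) = p t" "\<forall>t\<in>{0..1}. h (1, t) = p' t"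
    "\<forall>s\<in>{0..1}. h (s, 0) = p 0 \<and> h (s, 1) = p 1"
    using assms(1) by (rule path_homotopicE)
  obtain k where k: "continuous_map ?Q X k"
    "\<forall>t\<in>{0..1}. k (0, t) = q t" "\<forall>t\<in>{0..1}. k (1, t) = q' t"
    "\<forall>s\<in>{0..1}. k (s, 0) = q 0 \<and> k (s, 1) = q 1"
    using assms(2) by (rule path_homotopicE)
  \<comment> \<open>The two homotopies are placed side by side, each compressed to half of the
    second coordinate.\<close>
  define H where "H = (\<lambda>z. if snd z \<le> 1/2 then h (fst z, 2 * snd z) else k (fst z, 2 * snd z - 1))"
  have "continuous_map ?Q X H"
    unfolding H_def
  proof (rule continuous_map_cases_le)
    show "continuous_map ?Q euclideanreal snd"
      by (metis continuous_map_into_fulltopology continuous_map_snd)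
    show "continuous_map ?Q euclideanreal (\<lambda>z. 1/2)"
      by simp
    \<comment> \<open>On its closed half the rescaling lands back in the square, so it can be
      followed by \<open>h\<close>; likewise for \<open>k\<close> on the other half.\<close>
    have "continuous_map (subtopology ?Q {z \<in> topspace ?Q. snd z \<le> 1/2}) ?Q (\<lambda>z. (fst z, 2 * snd z))"
      by (auto simp: prod_topology_subtopology_eu subtopology_subtopology
          continuous_map_in_subtopology intro!: continuous_intros)
    from continuous_map_compose[OF this h(1)]
    show "continuous_map (subtopology ?Q {z \<in> topspace ?Q. snd z \<le> 1/2}) X (\<lambda>z. h (fst z, 2 * snd z))"
      by (simp add: o_def)
    have "continuous_map (subtopology ?Q {z \<in> topspace ?Q. 1/2 \<le> snd z}) ?Q (\<lambda>z. (fst z, 2 * snd z - 1))"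
      by (auto simp: prod_topology_subtopology_eu subtopology_subtopology
          continuous_map_in_subtopology intro!: continuous_intros)
    from continuous_map_compose[OF this k(1)]
    show "continuous_map (subtopology ?Q {z \<in> topspace ?Q. 1/2 \<le> snd z}) X (\<lambda>z. k (fst z, 2 * snd z - 1))"
      by (simp add: o_def)
    \<comment> \<open>On the seam both sides are the fixed value \<open>p 1 = q 0\<close>, because
      both homotopies are relative to the endpoints.\<close>
    show "h (fst z, 2 * snd z) = k (fst z, 2 * snd z - 1)" if "z \<in> topspace ?Q" "snd z = 1/2" for z
    proof -
      have "2 * snd z = 1" "fst z \<in> {0..1}"
        using that by auto
      then show ?thesis
        using h(4) k(4) pq by simp
    qed
  qed
  then show ?thesis
    unfolding path_homotopic_iff
    using h(2-4) k(2-4) by (intro exI[of _ H]) (auto simp: H_def path_concat_def)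
qed

text \<open>A function is homotopic to itself exactly when it is a path, so continuity is the
  reflexive case of the homotopy statement. The same device proves
  \<open>pathin_reverse\<close>.\<close>

lemma pathin_concat:
  assumes "pathin X p" "pathin X q" "p 1 = q 0"
  shows "pathin X (p \<star> q)"
  using assms path_homotopic_concat by (metis path_homotopic_refl)

lemma path_homotopic_reverse:
  assumes "path_homotopic X p q"
  shows "path_homotopic X (path_reverse p) (path_reverse q)"
proof -
  let ?I = "top_of_set {0..1::real}"
  let ?Q = "prod_topology ?I ?I"
  obtain h where h: "continuous_map ?Q X h"
    "\<forall>t\<in>{0..1}. h (0, t) = p t" "\<forall>t\<in>{0..1}. h (1, t) = q t"
    "\<forall>s\<in>{0..1}. h (s, 0) = p 0 \<and> h (s, 1) = p 1"
    using assms by (rule path_homotopicE)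
  have "continuous_map ?Q ?Q (\<lambda>z. (fst z, 1 - snd z))"
    by (auto simp: prod_topology_subtopology_eu continuous_map_in_subtopology
        intro!: continuous_intros)
  from continuous_map_compose[OF this h(1)]
  have "continuous_map ?Q X (\<lambda>z. h (fst z, 1 - snd z))"
    by (simp add: o_def)
  then show ?thesis
    unfolding path_homotopic_iff
    using h(2-4) by (intro exI[of _ "\<lambda>z. h (fst z, 1 - snd z)"]) (auto simp: path_reverse_def)
qed

lemma pathin_reverse: "pathin X p \<Longrightarrow> pathin X (path_reverse p)"
  using path_homotopic_reverse by (metis path_homotopic_refl)

section \<open>Endpoints, and the unit, inverse and associativity laws up to homotopy\<close>

lemma path_concat_endpoints [simp]:
  "(p \<star> q) 0 = p 0" "(p \<star> q) 1 = q 1"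
  by (auto simp: path_concat_def)

lemma path_reverse_endpoints [simp]:
  "path_reverse p 0 = p 1" "path_reverse p 1 = p 0"
  by (auto simp: path_reverse_def)

lemma path_homotopic_concat_const_left:
  assumes "pathin X p"
  shows "path_homotopic X ((\<lambda>_. p 0) \<star> p) p"
  \<comment> \<open>The parameter waits at 0 during the first half and then runs at double
    speed.\<close>
  by (rule path_homotopic_reparam[OF assms, of "\<lambda>t. max 0 (2 * t - 1)" "\<lambda>t. t"])
    (auto simp: path_concat_def max_absorb1 max_absorb2 intro!: continuous_intros)

lemma path_homotopic_concat_const_right:
  assumes "pathin X p"
  shows "path_homotopic X (p \<star> (\<lambda>_. p 1)) p"
  by (rule path_homotopic_reparam[OF assms, of "\<lambda>t. min 1 (2 * t)" "\<lambda>t. t"])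
    (auto simp: path_concat_def min_absorb1 min_absorb2 intro!: continuous_intros)

lemma path_homotopic_reverse_concat:
  assumes "pathin X p"
  shows "path_homotopic X (path_reverse p \<star> p) (\<lambda>_. p 1)"
\<comment> \<open>The parameter runs from 1 down to 0 and back up to 1; it is contracted to the
  constant parameter 1.\<close>
proof (rule path_homotopic_reparam[OF assms, of "\<lambda>t. \<bar>1 - 2 * t\<bar>" "\<lambda>_. 1"])
  show "continuous_on {0..1} (\<lambda>t::real. \<bar>1 - 2 * t\<bar>)"
    by (intro continuous_intros)
qed (auto simp: path_concat_def path_reverse_def)

lemma path_homotopic_concat_assoc:
  assumes "pathin X p" "pathin X q" "pathin X r" "p 1 = q 0" "q 1 = r 0"
  shows "path_homotopic X ((p \<star> q) \<star> r) (p \<star> q \<star> r)"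
proof -
  \<comment> \<open>This is the piecewise linear map with slopes 2, 1 and 1/2 and breaks at 1/4 and
    1/2. It sends the times at which the left bracketing runs \<open>p\<close>, \<open>q\<close>,
    \<open>r\<close> to those of the right bracketing. Being concave, it is the minimum of its three
    linear pieces. The other parameter function is the identity.\<close>
  define f where "f = (\<lambda>t::real. min (2 * t) (min (t + 1/4) (1/2 + t/2)))"
  show ?thesis
  proof (rule path_homotopic_reparam)
    show "pathin X (p \<star> q \<star> r)"
      using assms by (intro pathin_concat) auto
    show "continuous_on {0..1} f"
      unfolding f_def by (intro continuous_intros) auto
    show "f ` {0..1} \<subseteq> {0..1}" "f 0 = 0" "f 1 = 1"
      by (auto simp: f_def min_def)
    show "((p \<star> q) \<star> r) t = (p \<star> q \<star> r) (f t)" if "t \<in> {0..1}" for t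
    proof -
      consider "t \<le> 1/4" | "1/4 < t" "t \<le> 1/2" | "1/2 < t"
        by linarith
      then show ?thesis
      proof cases
        case 1
        then have "f t = 2 * t"
          by (simp add: f_def min_def)
        with 1 show ?thesis
          by (simp add: path_concat_def)
      next
        case 2
        then have "f t = t + 1/4"
          by (simp add: f_def min_def)
        with 2 show ?thesis
          by (simp add: path_concat_def algebra_simps)
      next
        case 3
        then have "f t = 1/2 + t/2"
          by (simp add: f_def min_def)
        with 3 show ?thesis
          by (simp add: path_concat_def algebra_simps)
      qed
    qed
  qed auto
qed


section \<open>The fundamental group\<close>

lemma loop_at_const: "x \<in> topspace X \<Longrightarrow> loop_at X x (\<lambda>_. x)"
  by (simp add: loop_at_def pathin_def)

lemma loop_at_concat: "loop_at X x p \<Longrightarrow> loop_at X x q \<Longrightarrow> loop_at X x (p \<star> q)"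
  by (simp add: loop_at_def pathin_concat)

lemma loop_at_reverse: "loop_at X x p \<Longrightarrow> loop_at X x (path_reverse p)"
  by (simp add: loop_at_def pathin_reverse)

lemma path_class_eq:
  assumes "path_homotopic X p q"
  shows "path_class X p = path_class X q"
  using assms by (auto simp: path_class_def intro: path_homotopic_trans path_homotopic_sym)

lemma path_class_eqD:
  assumes "path_class X p = path_class X q" "pathin X q"
  shows "path_homotopic X p q"
  using assms by (auto simp: path_class_def path_homotopic_refl)

lemma carrier_fundamental_group:
  "carrier (fundamental_group X x) = {path_class X p | p. loop_at X x p}"
  by (simp add: fundamental_group_def)

lemma one_fundamental_group: "\<one>\<^bsub>fundamental_group X x\<^esub> = path_class X (\<lambda>_. x)"
  by (simp add: fundamental_group_def)

lemma mult_fundamental_group: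
  assumes "loop_at X x p" "loop_at X x q"
  shows "path_class X p \<otimes>\<^bsub>fundamental_group X x\<^esub> path_class X q = path_class X (p \<star> q)"
proof -
  have "path_class X (p' \<star> q') = path_class X (p \<star> q)"
    if "p' \<in> path_class X p" "q' \<in> path_class X q" for p' q'
  proof -
    have "path_homotopic X (p \<star> q) (p' \<star> q')"
      using that assms by (intro path_homotopic_concat) (auto simp: path_class_def loop_at_def)
    then show ?thesis
      by (rule path_class_eq[symmetric])
  qed
  then have "(\<Union>p'\<in>path_class X p. \<Union>q'\<in>path_class X q. path_class X (p' \<star> q'))
    = (\<Union>p'\<in>path_class X p. \<Union>q'\<in>path_class X q. path_class X (p \<star> q))"
    by (intro SUP_cong refl)
  \<comment> \<open>A constant union equals its common value only over a nonempty index set; each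
    class contains its own path.\<close>
  moreover have "path_class X p \<noteq> {}" "path_class X q \<noteq> {}"
    using assms path_homotopic_refl unfolding path_class_def loop_at_def by blast+
  ultimately show ?thesis
    by (simp add: fundamental_group_def)
qed

lemma reverse_mult_fundamental_group:
  assumes "loop_at X x p"
  shows "path_class X (path_reverse p) \<otimes>\<^bsub>fundamental_group X x\<^esub> path_class X p
    = \<one>\<^bsub>fundamental_group X x\<^esub>"
  using assms path_class_eq[OF path_homotopic_reverse_concat[of X p]]
  by (simp add: mult_fundamental_group loop_at_reverse one_fundamental_group loop_at_def[of X x p])

text \<open>\<open>groupI\<close> asks for associativity, a left unit and left inverses, which are
  the homotopy laws above passed to classes by \<open>path_class_eq\<close>.\<close>

lemma group_fundamental_group:
  assumes "x \<in> topspace X"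
  shows "group (fundamental_group X x)" (is "group ?G")
proof (rule groupI)
  show "\<one>\<^bsub>?G\<^esub> \<in> carrier ?G"
    using loop_at_const[OF assms] by (auto simp: one_fundamental_group carrier_fundamental_group)
next
  fix A B assume "A \<in> carrier ?G" "B \<in> carrier ?G"
  then show "A \<otimes>\<^bsub>?G\<^esub> B \<in> carrier ?G"
    using mult_fundamental_group loop_at_concat by (fastforce simp: carrier_fundamental_group)
next
  fix A B C assume "A \<in> carrier ?G" "B \<in> carrier ?G" "C \<in> carrier ?G"
  then obtain p q r where pqr: "loop_at X x p" "loop_at X x q" "loop_at X x r"
    and ABC: "A = path_class X p" "B = path_class X q" "C = path_class X r"
    by (auto simp: carrier_fundamental_group)
  then show "A \<otimes>\<^bsub>?G\<^esub> B \<otimes>\<^bsub>?G\<^esub> C = A \<otimes>\<^bsub>?G\<^esub> (B \<otimes>\<^bsub>?G\<^esub> C)"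
    using path_class_eq[OF path_homotopic_concat_assoc[of X p q r]]
    by (simp add: mult_fundamental_group loop_at_concat) (simp add: loop_at_def)
next
  fix A assume "A \<in> carrier ?G"
  then obtain p where p: "loop_at X x p" and A: "A = path_class X p"
    by (auto simp: carrier_fundamental_group)
  then show "\<one>\<^bsub>?G\<^esub> \<otimes>\<^bsub>?G\<^esub> A = A"
    using path_class_eq[OF path_homotopic_concat_const_left[of X p]]
    by (simp add: mult_fundamental_group one_fundamental_group loop_at_const[OF assms])
      (simp add: loop_at_def)
  show "\<exists>B\<in>carrier ?G. B \<otimes>\<^bsub>?G\<^esub> A = \<one>\<^bsub>?G\<^esub>"
    using p A reverse_mult_fundamental_group loop_at_reverse
    by (fastforce simp: carrier_fundamental_group)
qed

lemma inv_fundamental_group: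
  assumes "x \<in> topspace X" "loop_at X x p"
  shows "inv\<^bsub>fundamental_group X x\<^esub> path_class X p = path_class X (path_reverse p)"
proof (rule group.inv_equality[OF group_fundamental_group[OF assms(1)]])
  show "path_class X (path_reverse p) \<otimes>\<^bsub>fundamental_group X x\<^esub> path_class X p
    = \<one>\<^bsub>fundamental_group X x\<^esub>"
    using assms(2) by (rule reverse_mult_fundamental_group)
qed (use assms(2) loop_at_reverse[OF assms(2)] in \<open>auto simp: carrier_fundamental_group\<close>)


section \<open>Small loops\<close>

text \<open>Turns "image contained in \<open>U\<close>" into "loop of the subspace
  \<open>U\<close>", so that the closure lemmas for loops apply inside \<open>U\<close>, while the
  homotopy still takes place in \<open>X\<close>.\<close>

lemma small_loop_iff:
  "small_loop X x \<alpha> \<longleftrightarrow> loop_at X x \<alpha> \<and>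
    (\<forall>U. openin X U \<and> x \<in> U \<longrightarrow> (\<exists>\<beta>. path_homotopic X \<alpha> \<beta> \<and> loop_at (subtopology X U) x \<beta>))"
proof -
  have "(\<exists>\<beta>\<in>path_class X \<alpha>. \<beta> ` {0..1} \<subseteq> U) \<longleftrightarrow>
    (\<exists>\<beta>. path_homotopic X \<alpha> \<beta> \<and> loop_at (subtopology X U) x \<beta>)" if "loop_at X x \<alpha>" for U
  proof -
    have "\<beta> ` {0..1} \<subseteq> U \<longleftrightarrow> loop_at (subtopology X U) x \<beta>" if "path_homotopic X \<alpha> \<beta>" for \<beta>
      using path_homotopic_endpoints[OF that] path_homotopic_pathin[OF that] \<open>loop_at X x \<alpha>\<close>
      by (simp add: loop_at_def pathin_subtopology image_subset_iff)
    then show ?thesis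
      by (auto simp: path_class_def)
  qed
  then show ?thesis
    unfolding small_loop_def by blast
qed

lemma small_loop_cong:
  assumes "small_loop X x \<alpha>" "path_homotopic X \<alpha> \<beta>"
  shows "small_loop X x \<beta>"
  using assms path_homotopic_endpoints[OF assms(2)] path_homotopic_pathin[OF assms(2)]
    path_class_eq[OF assms(2)]
  by (simp add: small_loop_def loop_at_def)

text \<open>Membership in \<open>pi1_small\<close> only provides some small loop with the same
  class; smallness passes from it to \<open>\<beta>\<close> because it is invariant under
  homotopy.\<close>

lemma small_loop_if_path_class_mem:
  assumes "loop_at X x \<beta>" "path_class X \<beta> \<in> pi1_small X x"
  shows "small_loop X x \<beta>"
proof -
  obtain \<alpha> where "small_loop X x \<alpha>" "path_class X \<alpha> = path_class X \<beta>"
    using assms(2) by (auto simp: pi1_small_def)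
  then show ?thesis
    using assms(1) by (auto simp: loop_at_def intro: small_loop_cong[OF _ path_class_eqD])
qed

lemma small_loop_const:
  assumes "x \<in> topspace X"
  shows "small_loop X x (\<lambda>_. x)"
  unfolding small_loop_iff
proof (intro conjI allI impI exI)
  show "path_homotopic X (\<lambda>_. x) (\<lambda>_. x)"
    using assms by (simp add: path_homotopic_refl)
qed (use assms in \<open>auto intro: loop_at_const\<close>)

lemma small_loop_concat:
  assumes "small_loop X x p" "small_loop X x q"
  shows "small_loop X x (p \<star> q)"
  unfolding small_loop_iff
proof (intro conjI allI impI)
  show "loop_at X x (p \<star> q)"
    using assms loop_at_concat by (auto simp: small_loop_def)
  fix U assume "openin X U \<and> x \<in> U"
  then obtain p' q' where p': "path_homotopic X p p'" "loop_at (subtopology X U) x p'"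
    and q': "path_homotopic X q q'" "loop_at (subtopology X U) x q'"
    using assms unfolding small_loop_iff by metis
  have "p 1 = q 0"
    using assms by (auto simp: small_loop_def loop_at_def)
  \<comment> \<open>\<open>path_homotopic_concat\<close> is used in \<open>X\<close>, but
    \<open>loop_at_concat\<close> in \<open>subtopology X U\<close>.\<close>
  with p' q' show "\<exists>\<beta>. path_homotopic X (p \<star> q) \<beta> \<and> loop_at (subtopology X U) x \<beta>"
    by (intro exI[of _ "p' \<star> q'"] conjI path_homotopic_concat loop_at_concat)
qed

lemma small_loop_reverse:
  assumes "small_loop X x p"
  shows "small_loop X x (path_reverse p)"
  unfolding small_loop_iff
proof (intro conjI allI impI)
  show "loop_at X x (path_reverse p)"
    using assms loop_at_reverse by (auto simp: small_loop_def)
  fix U assume "openin X U \<and> x \<in> U"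
  then obtain p' where "path_homotopic X p p'" "loop_at (subtopology X U) x p'"
    using assms unfolding small_loop_iff by metis
  then show "\<exists>\<beta>. path_homotopic X (path_reverse p) \<beta> \<and> loop_at (subtopology X U) x \<beta>"
    by (intro exI[of _ "path_reverse p'"] conjI path_homotopic_reverse loop_at_reverse)
qed

section \<open>Small classes as a subgroup, and the two inclusions\<close>

lemma subgroup_pi1_small:
  assumes "x \<in> topspace X"
  shows "subgroup (pi1_small X x) (fundamental_group X x)" (is "subgroup ?S ?G")
proof -
  have "loop_at X x p" if "small_loop X x p" for p
    using that by (simp add: small_loop_def)
  note [simp] = this
  show ?thesis
  proof (rule group.subgroupI[OF group_fundamental_group[OF assms]])
    show "?S \<subseteq> carrier ?G"
      by (auto simp: pi1_small_def carrier_fundamental_group)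
    show "?S \<noteq> {}"
      using small_loop_const[OF assms] by (auto simp: pi1_small_def)
  next
    fix A assume "A \<in> ?S"
    then obtain p where "small_loop X x p" "A = path_class X p"
      by (auto simp: pi1_small_def)
    then show "inv\<^bsub>?G\<^esub> A \<in> ?S"
      using small_loop_reverse[of X x p] by (auto simp: pi1_small_def inv_fundamental_group[OF assms])
  next
    fix A B assume "A \<in> ?S" "B \<in> ?S"
    then obtain p q where "small_loop X x p" "small_loop X x q" "A = path_class X p" "B = path_class X q"
      by (auto simp: pi1_small_def)
    moreover from this have "small_loop X x (p \<star> q)"
      by (intro small_loop_concat)
    ultimately show "A \<otimes>\<^bsub>?G\<^esub> B \<in> ?S"
      by (auto simp: pi1_small_def mult_fundamental_group)
  qed
qed

text \<open>Given \<open>U\<close> around \<open>\<alpha> 0\<close>, transfer supplies a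
  neighborhood \<open>V\<close> of \<open>\<alpha> 1\<close>. Smallness replaces
  \<open>\<beta>\<close> by a loop \<open>\<gamma>\<close> in \<open>V\<close>, and transfer then
  moves the conjugate of \<open>\<gamma>\<close> into \<open>U\<close>.\<close>

lemma SLT_path_small_loop_conjugate:
  assumes "SLT_path X \<alpha>" "small_loop X (\<alpha> 1) \<beta>"
  shows "small_loop X (\<alpha> 0) (\<alpha> \<star> \<beta> \<star> path_reverse \<alpha>)"
proof -
  have \<alpha>: "pathin X \<alpha>"
    using assms(1) by (simp add: SLT_path_def)
  have \<beta>: "pathin X \<beta>" "\<beta> 0 = \<alpha> 1" "\<beta> 1 = \<alpha> 1"
    using assms(2) by (auto simp: small_loop_def loop_at_def)
  show ?thesis
    unfolding small_loop_iff
  proof (intro conjI allI impI)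
    show "loop_at X (\<alpha> 0) (\<alpha> \<star> \<beta> \<star> path_reverse \<alpha>)"
      using \<alpha> \<beta> by (simp add: loop_at_def pathin_concat pathin_reverse)
    fix U assume "openin X U \<and> \<alpha> 0 \<in> U"
    then obtain V where "openin X V" "\<alpha> 1 \<in> V"
      and V: "\<And>\<gamma>. loop_at (subtopology X V) (\<alpha> 1) \<gamma> \<Longrightarrow>
        \<exists>\<gamma>'. loop_at (subtopology X U) (\<alpha> 0) \<gamma>' \<and>
             path_homotopic X \<gamma>' (\<alpha> \<star> \<gamma> \<star> path_reverse \<alpha>)"
      using assms(1) unfolding SLT_path_def by meson
    then obtain \<gamma> where \<gamma>: "path_homotopic X \<beta> \<gamma>" "loop_at (subtopology X V) (\<alpha> 1) \<gamma>"
      using assms(2) unfolding small_loop_iff by blast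
    obtain \<gamma>' where \<gamma>': "loop_at (subtopology X U) (\<alpha> 0) \<gamma>'"
      "path_homotopic X \<gamma>' (\<alpha> \<star> \<gamma> \<star> path_reverse \<alpha>)"
      using V[OF \<gamma>(2)] by blast
    \<comment> \<open>The homotopy from \<open>\<beta>\<close> to \<open>\<gamma>\<close> is flanked
      by the constant homotopies of \<open>\<alpha>\<close> and its reverse.\<close>
    have "path_homotopic X (\<alpha> \<star> \<beta> \<star> path_reverse \<alpha>) (\<alpha> \<star> \<gamma> \<star> path_reverse \<alpha>)"
      using \<alpha> \<beta> \<gamma>(1) by (intro path_homotopic_concat) (auto simp: path_homotopic_refl pathin_reverse)
    then show "\<exists>\<delta>. path_homotopic X (\<alpha> \<star> \<beta> \<star> path_reverse \<alpha>) \<delta> \<and>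
        loop_at (subtopology X U) (\<alpha> 0) \<delta>"
      using \<gamma>' path_homotopic_sym path_homotopic_trans by blast
  qed
qed

lemma pi1_small_subset_pi1_sg:
  assumes "x \<in> topspace X"
  shows "pi1_small X x \<subseteq> pi1_sg X x"
proof
  fix A assume A: "A \<in> pi1_small X x"
  then obtain \<beta> where \<beta>: "loop_at X x \<beta>" "A = path_class X \<beta>"
    by (auto simp: pi1_small_def small_loop_def)
  let ?c = "\<lambda>_::real. x"
  have c: "pathin X ?c" "path_reverse ?c = ?c"
    using assms by (auto simp: pathin_def path_reverse_def)
  \<comment> \<open>Concatenation associates to the right, so the trailing constant is absorbed
    first, inside the right factor. The constant path is literally its own reverse, so this is a
    generator of \<open>pi1_sg\<close>.\<close>
  have "path_homotopic X (?c \<star> \<beta> \<star> ?c) (?c \<star> \<beta>)"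
    using \<beta> c path_homotopic_concat_const_right[of X \<beta>]
    by (intro path_homotopic_concat) (auto simp: loop_at_def path_homotopic_refl)
  also have "path_homotopic X (?c \<star> \<beta>) \<beta>"
    using \<beta> path_homotopic_concat_const_left[of X \<beta>] by (simp add: loop_at_def)
  finally have "A = path_class X (?c \<star> \<beta> \<star> path_reverse ?c)"
    using \<beta> c path_class_eq by metis
  then show "A \<in> pi1_sg X x"
    unfolding pi1_sg_def using A \<beta> c
    by (intro generate.incl CollectI exI[of _ ?c] exI[of _ \<beta>]) simp
qed

theorem proposition3p2:
  fixes X :: "'a topology" and x0 :: 'a
  assumes "x0 \<in> topspace X"
    and "SLT_at X x0"
  shows "pi1_small X x0 = pi1_sg X x0"
proof
  show "pi1_small X x0 \<subseteq> pi1_sg X x0"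
    using assms(1) by (rule pi1_small_subset_pi1_sg)
  show "pi1_sg X x0 \<subseteq> pi1_small X x0"
    unfolding pi1_sg_def
  \<comment> \<open>The generated subgroup lies in every subgroup containing the generators, so only
    the generators have to be checked.\<close>
  proof (rule group.generate_subgroup_incl[OF group_fundamental_group _ subgroup_pi1_small])
    have "small_loop X x0 (\<alpha> \<star> \<beta> \<star> path_reverse \<alpha>)"
      if "pathin X \<alpha>" "\<alpha> 0 = x0" "loop_at X (\<alpha> 1) \<beta>" "path_class X \<beta> \<in> pi1_small X (\<alpha> 1)" for \<alpha> \<beta>
    proof -
      have "SLT_path X \<alpha>"
        using assms(2) that by (simp add: SLT_at_def)
      moreover have "small_loop X (\<alpha> 1) \<beta>"
        using that by (intro small_loop_if_path_class_mem)
      ultimately show ?thesis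
        using SLT_path_small_loop_conjugate that(2) by metis
    qed
    then show "{path_class X (\<alpha> \<star> \<beta> \<star> path_reverse \<alpha>) | \<alpha> \<beta>. pathin X \<alpha> \<and> \<alpha> 0 = x0 \<and>
        loop_at X (\<alpha> 1) \<beta> \<and> path_class X \<beta> \<in> pi1_small X (\<alpha> 1)} \<subseteq> pi1_small X x0"
      by (auto simp: pi1_small_def[of X x0])
  qed (use assms in auto)
qed

end
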